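(* Let $(V,\Delta)$ be a BPP with $V=\{X_1,\dots,X_n\}$, let $\varphi$ be an EG-formula, let $s\in\mathbb{N}^n$ be a BPP state, and let $k$ be a natural number. Then: (i) (Termination) the recursive construction of $\mathit{Trans}(\varphi,s,k)$ terminates after finitely many steps; (ii) (Reliability) if $s\models_k\varphi$ then the closed linear integer arithmetic formula $\mathit{Trans}(\varphi,s,k)$ is true over $\mathbb{Z}$; (iii) (Soundness) if $\mathit{Trans}(\varphi,s,k)$ is true over $\mathbb{Z}$ then $s\models_k\varphi$.
   Context: A BPP is a pair $(V,\Delta)$ with $V=\{X_1,\dots,X_n\}$ finite and $\Delta$ a finite set of labelled rules $X\xrightarrow{a}\alpha$, $X\in V$, $a$ an action, $\alpha\in V^{\oplus}$ a finite multiset of symbols; states are multisets over $V$, identified with Parikh vectors in $\mathbb{N}^n$. A rule $X\xrightarrow{a}\alpha$ induces transitions $\beta X\gamma\xrightarrow{a}\beta\alpha\gamma$ (multiset union). For $r=X\xrightarrow{a}\alpha$ write ${}^{\bullet}r=X$, $r^{\bullet}=\alpha$, $r^{act}=a$; for a vector $s$, $s({}^{\bullet}r)=s_i$ where ${}^{\bullet}r=X_i$. Let $P^{-}({}^{\bullet}r,r^{\bullet})_i=r^{\bullet}(X_i)-1$ if $X_i={}^{\bullet}r$ and $=r^{\bullet}(X_i)$ otherwise; $T^{-}(s,t,r):=\bigwedge_{i}(s_i+P^{-}({}^{\bullet}r,r^{\bullet})_i=t_i)$; $T(s,t,a):=\bigvee_{r\in\Delta}(r^{act}=a\wedge s({}^{\bullet}r)\ge1\wedge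 T^{-}(s,t,r))$; $\mathit{Path}(u(0),\dots,u(k)):=\bigwedge_{j=1}^k\bigvee_{r\in\Delta}(u(j-1)({}^{\bullet}r)\ge1\wedge T^{-}(u(j-1),u(j),r))$. EG-formulas: $\varphi::=\mathbf{a}\mathbf{m}^T\ge b\mid\neg\varphi\mid\varphi\wedge\varphi\mid\mathbf{E}\langle a\rangle\varphi\mid\mathbf{EG}\varphi$ with $\mathbf{m}=(X_1,\dots,X_n)$, $\mathbf{a}\in\mathbb{N}^n$, $b\in\mathbb{N}$. $\mathit{Trans}(\varphi,s,k)$ is defined recursively with fresh integer variables: atom $\mapsto \mathbf{a}s^T\ge b$; $\neg\varphi_1\mapsto\neg\mathit{Trans}(\varphi_1,s,k)$; $\varphi_1\wedge\varphi_2\mapsto$ conjunction of translations; $\mathbf{E}\langle a\rangle\varphi_1\mapsto k\ge1\wedge\exists t_1\cdots t_n.(T(s,t,a)\wedge\mathit{Trans}(\varphi_1,t,k))$; $\mathbf{EG}\varphi_1\mapsto\exists u(0)_1\cdots u(k)_n.\,\mathit{Path}(u(0),\dots,u(k))\wedge\bigwedge_i u(0)_i=s_i\wedge\bigwedge_{j=0}^k\mathit{Trans}(\varphi_1,u(j),k)$. The $k$-step bounded semantics: $s\models_k\mathbf{a}\mathbf{m}^T\ge b$ iff $\mathbf{a}s^T\ge b$; $s\models_k\neg\varphi$ iff not $s\models_k\varphi$; $s\models_k\varphi_1\wedge\varphi_2$ iff both hold; $s\models_k\mathbf{E}\langle a\rangle\varphi$ iff $k\ge1$ and there is a state $t$ with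 $s\xrightarrow{a}t$ and $t\models_k\varphi$; $s\models_k\mathbf{EG}\varphi$ iff there are states $\pi(0)=s,\pi(1),\dots,\pi(k)$ with $\pi(j-1)\xrightarrow{b_j}\pi(j)$ for some actions $b_j$ ($1\le j\le k$) and $\pi(i)\models_k\varphi$ for all $0\le i\le k$. *)

theory Defs
  imports "HOL-Library.Multiset"
begin

section \<open>Basic parallel processes\<close>

datatype ('v, 'a) rule = Rule (pre: 'v) (act: 'a) (post: "'v multiset")

definition is_bpp :: "'v set \<Rightarrow> ('v, 'a) rule set \<Rightarrow> bool" where
  "is_bpp V \<Delta> \<longleftrightarrow> finite V \<and> finite \<Delta> \<and> (\<forall>r\<in>\<Delta>. pre r \<in> V \<and> set_mset (post r) \<subseteq> V)"

text \<open>The Parikh vector of a state \<open>s\<close> is \<open>count s\<close>, indexed by the symbols themselves.\<close>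

definition bpp_states :: "'v set \<Rightarrow> 'v multiset set" where
  "bpp_states V = {s. set_mset s \<subseteq> V}"

definition bpp_step :: "('v, 'a) rule set \<Rightarrow> 'v multiset \<Rightarrow> 'a \<Rightarrow> 'v multiset \<Rightarrow> bool" where
  "bpp_step \<Delta> s a t \<longleftrightarrow>
     (\<exists>r\<in>\<Delta>. \<exists>\<beta>. act r = a \<and> s = \<beta> + {#pre r#} \<and> t = \<beta> + post r)"


section \<open>EG-formulas and their bounded semantics\<close>

text \<open>In \<open>Atom a b\<close> the coefficient vector \<open>a\<close> is indexed by symbols; only its values on the
  symbols of the process are ever used.\<close>

datatype ('v, 'a) eg_formula =
    Atom "'v \<Rightarrow> nat" nat
  | Neg "('v, 'a) eg_formula"
  | Conj "('v, 'a) eg_formula" "('v, 'a) eg_formula"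
  | ExNext 'a "('v, 'a) eg_formula"
  | ExGlobally "('v, 'a) eg_formula"

primrec bounded_sat ::
  "'v set \<Rightarrow> ('v, 'a) rule set \<Rightarrow> nat \<Rightarrow> 'v multiset \<Rightarrow> ('v, 'a) eg_formula \<Rightarrow> bool" where
  "bounded_sat V \<Delta> k s (Atom a b) \<longleftrightarrow> (\<Sum>X\<in>V. a X * count s X) \<ge> b"
| "bounded_sat V \<Delta> k s (Neg \<phi>) \<longleftrightarrow> \<not> bounded_sat V \<Delta> k s \<phi>"
| "bounded_sat V \<Delta> k s (Conj \<phi> \<psi>) \<longleftrightarrow> bounded_sat V \<Delta> k s \<phi> \<and> bounded_sat V \<Delta> k s \<psi>"
| "bounded_sat V \<Delta> k s (ExNext a \<phi>) \<longleftrightarrow>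
     k \<ge> 1 \<and> (\<exists>t\<in>bpp_states V. bpp_step \<Delta> s a t \<and> bounded_sat V \<Delta> k t \<phi>)"
| "bounded_sat V \<Delta> k s (ExGlobally \<phi>) \<longleftrightarrow>
     (\<exists>\<pi> :: nat \<Rightarrow> 'v multiset. \<pi> 0 = s \<and> (\<forall>j\<le>k. \<pi> j \<in> bpp_states V) \<and>
        (\<forall>j\<in>{1..k}. \<exists>b. bpp_step \<Delta> (\<pi> (j - 1)) b (\<pi> j)) \<and>
        (\<forall>i\<le>k. bounded_sat V \<Delta> k (\<pi> i) \<phi>))"


section \<open>Linear integer arithmetic\<close>

datatype 'x lterm = LVar 'x | LConst int | LAdd "'x lterm" "'x lterm" | LScale int "'x lterm"

datatype 'x lia =
    LBool bool
  | LGe "'x lterm" "'x lterm"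
  | LEq "'x lterm" "'x lterm"
  | LNot "'x lia"
  | LAnd "'x lia" "'x lia"
  | LOr "'x lia" "'x lia"
  | LEx 'x "'x lia"

primrec lterm_val :: "('x \<Rightarrow> int) \<Rightarrow> 'x lterm \<Rightarrow> int" where
  "lterm_val \<rho> (LVar x) = \<rho> x"
| "lterm_val \<rho> (LConst c) = c"
| "lterm_val \<rho> (LAdd p q) = lterm_val \<rho> p + lterm_val \<rho> q"
| "lterm_val \<rho> (LScale c p) = c * lterm_val \<rho> p"

primrec lia_sat :: "('x \<Rightarrow> int) \<Rightarrow> 'x lia \<Rightarrow> bool" where
  "lia_sat \<rho> (LBool c) \<longleftrightarrow> c"
| "lia_sat \<rho> (LGe p q) \<longleftrightarrow> lterm_val \<rho> p \<ge> lterm_val \<rho> q"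
| "lia_sat \<rho> (LEq p q) \<longleftrightarrow> lterm_val \<rho> p = lterm_val \<rho> q"
| "lia_sat \<rho> (LNot F) \<longleftrightarrow> \<not> lia_sat \<rho> F"
| "lia_sat \<rho> (LAnd F G) \<longleftrightarrow> lia_sat \<rho> F \<and> lia_sat \<rho> G"
| "lia_sat \<rho> (LOr F G) \<longleftrightarrow> lia_sat \<rho> F \<or> lia_sat \<rho> G"
| "lia_sat \<rho> (LEx x F) \<longleftrightarrow> (\<exists>z. lia_sat (\<rho>(x := z)) F)"

primrec lterm_vars :: "'x lterm \<Rightarrow> 'x set" where
  "lterm_vars (LVar x) = {x}"
| "lterm_vars (LConst c) = {}"
| "lterm_vars (LAdd p q) = lterm_vars p \<union> lterm_vars q"
| "lterm_vars (LScale c p) = lterm_vars p"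

primrec lia_free :: "'x lia \<Rightarrow> 'x set" where
  "lia_free (LBool c) = {}"
| "lia_free (LGe p q) = lterm_vars p \<union> lterm_vars q"
| "lia_free (LEq p q) = lterm_vars p \<union> lterm_vars q"
| "lia_free (LNot F) = lia_free F"
| "lia_free (LAnd F G) = lia_free F \<union> lia_free G"
| "lia_free (LOr F G) = lia_free F \<union> lia_free G"
| "lia_free (LEx x F) = lia_free F - {x}"

definition lia_closed :: "'x lia \<Rightarrow> bool" where
  "lia_closed F \<longleftrightarrow> lia_free F = {}"

definition lia_true :: "'x lia \<Rightarrow> bool" where
  "lia_true F \<longleftrightarrow> (\<forall>\<rho>. lia_sat \<rho> F)"

definition lsum :: "'x lterm list \<Rightarrow> 'x lterm" where
  "lsum ps = foldr LAdd ps (LConst 0)"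

definition lconj :: "'x lia list \<Rightarrow> 'x lia" where
  "lconj Fs = foldr LAnd Fs (LBool True)"

definition ldisj :: "'x lia list \<Rightarrow> 'x lia" where
  "ldisj Fs = foldr LOr Fs (LBool False)"

definition lexists :: "'x list \<Rightarrow> 'x lia \<Rightarrow> 'x lia" where
  "lexists xs F = foldr LEx xs F"


section \<open>The translation\<close>

text \<open>\<open>Xs\<close> and \<open>rs\<close> enumerate the symbols and the rules. Integer variables are pairs \<open>(m, X)\<close>:
  the component for symbol \<open>X\<close> of the \<open>m\<close>-th vector of variables.\<close>

type_synonym 'v vec = "'v \<Rightarrow> (nat \<times> 'v) lterm"

definition var_vec :: "nat \<Rightarrow> 'v vec" where
  "var_vec m = (\<lambda>X. LVar (m, X))"

definition const_vec :: "'v multiset \<Rightarrow> 'v vec" where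
  "const_vec s = (\<lambda>X. LConst (int (count s X)))"

definition P_minus :: "'v \<Rightarrow> 'v multiset \<Rightarrow> 'v \<Rightarrow> int" where
  "P_minus Y \<alpha> X = (if X = Y then int (count \<alpha> X) - 1 else int (count \<alpha> X))"

definition T_minus :: "'v list \<Rightarrow> 'v vec \<Rightarrow> 'v vec \<Rightarrow> ('v, 'a) rule \<Rightarrow> (nat \<times> 'v) lia" where
  "T_minus Xs s t r =
     lconj (map (\<lambda>X. LEq (LAdd (s X) (LConst (P_minus (pre r) (post r) X))) (t X)) Xs)"

definition T_form ::
  "'v list \<Rightarrow> ('v, 'a) rule list \<Rightarrow> 'v vec \<Rightarrow> 'v vec \<Rightarrow> 'a \<Rightarrow> (nat \<times> 'v) lia" where
  "T_form Xs rs s t a =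
     ldisj (map (\<lambda>r. LAnd (LBool (act r = a))
                     (LAnd (LGe (s (pre r)) (LConst 1)) (T_minus Xs s t r))) rs)"

definition Path_form ::
  "'v list \<Rightarrow> ('v, 'a) rule list \<Rightarrow> (nat \<Rightarrow> 'v vec) \<Rightarrow> nat \<Rightarrow> (nat \<times> 'v) lia" where
  "Path_form Xs rs u k =
     lconj (map (\<lambda>j. ldisj (map (\<lambda>r. LAnd (LGe (u (j - 1) (pre r)) (LConst 1))
                                       (T_minus Xs (u (j - 1)) (u j) r)) rs)) [1..<Suc k])"

text \<open>The argument \<open>m\<close> supplies fresh variables: all variables in scope belong to vectors with
  index below \<open>m\<close>. No termination proof is attached to the definition: termination on
  given arguments is expressed by the domain predicate \<open>Trans_dom\<close>, the accessible part of the
  relation \<open>Trans_rel\<close> between direct recursive calls and their caller.\<close>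

function (domintros) Trans ::
  "'v list \<Rightarrow> ('v, 'a) rule list \<Rightarrow> ('v, 'a) eg_formula \<Rightarrow> 'v vec \<Rightarrow> nat \<Rightarrow> nat \<Rightarrow> (nat \<times> 'v) lia"
where
  "Trans Xs rs (Atom a b) s k m =
     LGe (lsum (map (\<lambda>X. LScale (int (a X)) (s X)) Xs)) (LConst (int b))"
| "Trans Xs rs (Neg \<phi>) s k m = LNot (Trans Xs rs \<phi> s k m)"
| "Trans Xs rs (Conj \<phi> \<psi>) s k m = LAnd (Trans Xs rs \<phi> s k m) (Trans Xs rs \<psi> s k m)"
| "Trans Xs rs (ExNext a \<phi>) s k m =
     LAnd (LGe (LConst (int k)) (LConst 1))
       (lexists (map (Pair m) Xs)
         (LAnd (T_form Xs rs s (var_vec m) a) (Trans Xs rs \<phi> (var_vec m) k (m + 1))))"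
| "Trans Xs rs (ExGlobally \<phi>) s k m =
     lexists (List.product [m..<m + k + 1] Xs)
       (LAnd (Path_form Xs rs (\<lambda>j. var_vec (m + j)) k)
         (LAnd (lconj (map (\<lambda>X. LEq (var_vec m X) (s X)) Xs))
           (lconj (map (\<lambda>j. Trans Xs rs \<phi> (var_vec (m + j)) k (m + k + 1)) [0..<Suc k]))))"
  by pat_completeness auto

end

theory Submission
  imports Defs
begin

text \<open>Both directions are one equivalence, proved by induction on the formula for an arbitrary
  vector of terms whose value under the current assignment is the Parikh vector of a state.
  An integer solution of the transition constraint is automatically a state: the guard
  \<open>s(pre r) \<ge> 1\<close> compensates the only negative entry of the effect of a rule, so every
  quantified integer vector that the constraints reach from a Parikh vector is a Parikh vector.
  Quantifying over fresh variables does not change the value of the vectors already in scope.\<close>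

section \<open>Termination\<close>

lemma Trans_dom_all: "Trans_dom (Xs, rs, \<phi>, s, k, m)"
  by (induction \<phi> arbitrary: s m) (auto intro: Trans.domintros)

termination Trans
  using Trans_dom_all by auto

text \<open>Accessibility alone would allow a call with infinitely many direct calls. Finite
  termination also needs finite branching: the descendants of \<open>x\<close> are \<open>x\<close>
  and the descendants of its finitely many direct calls.\<close>

lemma finite_rtranclp_predecessors:
  assumes "finite A" and "\<And>y. R y x \<Longrightarrow> y \<in> A" and "\<And>y. y \<in> A \<Longrightarrow> finite {c. R\<^sup>*\<^sup>* c y}"
  shows "finite {c. R\<^sup>*\<^sup>* c x}"
proof -
  have "{c. R\<^sup>*\<^sup>* c x} \<subseteq> insert x (\<Union>y\<in>A. {c. R\<^sup>*\<^sup>* c y})"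
    using assms(2) by (auto elim: rtranclp.cases)
  moreover have "finite (insert x (\<Union>y\<in>A. {c. R\<^sup>*\<^sup>* c y}))"
    using assms(1,3) by simp
  ultimately show ?thesis
    by (rule finite_subset)
qed

lemma finite_Trans_calls: "finite {c. Trans_rel\<^sup>*\<^sup>* c (Xs, rs, \<phi>, s, k, m)}"
proof (induction \<phi> arbitrary: s m)
  case (Atom a b)
  show ?case
    by (rule finite_rtranclp_predecessors[where A = "{}"]) (auto elim: Trans_rel.cases)
next
  case (Neg \<phi>)
  show ?case
  proof (rule finite_rtranclp_predecessors[where A = "{(Xs, rs, \<phi>, s, k, m)}"])
    show "y \<in> {(Xs, rs, \<phi>, s, k, m)}" if "Trans_rel y (Xs, rs, Neg \<phi>, s, k, m)" for y
      using that by cases auto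
  qed (use Neg in auto)
next
  case (Conj \<phi> \<psi>)
  show ?case
  proof (rule finite_rtranclp_predecessors
      [where A = "{(Xs, rs, \<phi>, s, k, m), (Xs, rs, \<psi>, s, k, m)}"])
    show "y \<in> {(Xs, rs, \<phi>, s, k, m), (Xs, rs, \<psi>, s, k, m)}"
      if "Trans_rel y (Xs, rs, Conj \<phi> \<psi>, s, k, m)" for y
      using that by cases auto
  qed (use Conj in auto)
next
  case (ExNext a \<phi>)
  show ?case
  proof (rule finite_rtranclp_predecessors[where A = "{(Xs, rs, \<phi>, var_vec m, k, m + 1)}"])
    show "y \<in> {(Xs, rs, \<phi>, var_vec m, k, m + 1)}"
      if "Trans_rel y (Xs, rs, ExNext a \<phi>, s, k, m)" for y
      using that by cases auto
  qed (use ExNext in auto)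
next
  case (ExGlobally \<phi>)
  \<comment> \<open>The calls sit below a \<open>map\<close>, and \<open>Trans_rel\<close> records
    that \<open>j\<close> comes from the mapped list, so there are only k + 1 candidates.\<close>
  let ?calls = "(\<lambda>j. (Xs, rs, \<phi>, var_vec (m + j), k, m + k + 1)) ` set [0..<Suc k]"
  show ?case
  proof (rule finite_rtranclp_predecessors[where A = ?calls])
    show "y \<in> ?calls" if "Trans_rel y (Xs, rs, ExGlobally \<phi>, s, k, m)" for y
      using that by cases (auto simp del: upt_Suc)
  qed (use ExGlobally in auto)
qed

section \<open>Linear integer arithmetic\<close>

lemma lterm_val_lsum: "lterm_val \<rho> (lsum ps) = (\<Sum>p\<leftarrow>ps. lterm_val \<rho> p)"
  by (induction ps) (auto simp: lsum_def)

lemma lia_sat_lconj: "lia_sat \<rho> (lconj Fs) \<longleftrightarrow> (\<forall>F\<in>set Fs. lia_sat \<rho> F)"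
  by (induction Fs) (auto simp: lconj_def)

lemma lia_sat_ldisj: "lia_sat \<rho> (ldisj Fs) \<longleftrightarrow> (\<exists>F\<in>set Fs. lia_sat \<rho> F)"
  by (induction Fs) (auto simp: ldisj_def)

text \<open>Turns a block of quantifiers into one choice of an assignment, so that whole vectors can
  be supplied at once as witnesses.\<close>

lemma lia_sat_lexists:
  "lia_sat \<rho> (lexists xs F) \<longleftrightarrow> (\<exists>\<sigma>. (\<forall>x. x \<notin> set xs \<longrightarrow> \<sigma> x = \<rho> x) \<and> lia_sat \<sigma> F)"
proof (induction xs arbitrary: \<rho>)
  case Nil
  have "(\<forall>x. \<sigma> x = \<rho> x) \<longleftrightarrow> \<sigma> = \<rho>" for \<sigma>
    by auto
  then show ?case
    by (simp add: lexists_def)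
next
  case (Cons y xs)
  have "lia_sat \<rho> (lexists (y # xs) F) \<longleftrightarrow>
      (\<exists>z \<sigma>. (\<forall>x. x \<notin> set xs \<longrightarrow> \<sigma> x = (\<rho>(y := z)) x) \<and> lia_sat \<sigma> F)"
    using Cons.IH by (simp add: lexists_def)
  also have "\<dots> \<longleftrightarrow> (\<exists>\<sigma>. (\<forall>x. x \<notin> set (y # xs) \<longrightarrow> \<sigma> x = \<rho> x) \<and> lia_sat \<sigma> F)"
    (is "?L \<longleftrightarrow> ?R")
  proof
    assume ?L
    then show ?R by (auto split: if_splits)
  next
    assume ?R
    then obtain \<sigma> where \<sigma>: "\<forall>x. x \<notin> set (y # xs) \<longrightarrow> \<sigma> x = \<rho> x" "lia_sat \<sigma> F"
      by blast
    \<comment> \<open>The outermost quantifier takes its value from the final assignment; if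
      \<open>y\<close> recurs in \<open>xs\<close>, it is simply chosen again.\<close>
    then have "\<forall>x. x \<notin> set xs \<longrightarrow> \<sigma> x = (\<rho>(y := \<sigma> y)) x"
      by simp
    with \<sigma>(2) show ?L by blast
  qed
  finally show ?case .
qed

lemma lterm_vars_lsum: "lterm_vars (lsum ps) = (\<Union>p\<in>set ps. lterm_vars p)"
  by (induction ps) (auto simp: lsum_def)

lemma lia_free_lconj: "lia_free (lconj Fs) = (\<Union>F\<in>set Fs. lia_free F)"
  by (induction Fs) (auto simp: lconj_def)

lemma lia_free_ldisj: "lia_free (ldisj Fs) = (\<Union>F\<in>set Fs. lia_free F)"
  by (induction Fs) (auto simp: ldisj_def)

lemma lia_free_lexists: "lia_free (lexists xs F) = lia_free F - set xs"
  by (induction xs) (auto simp: lexists_def)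

lemma lterm_val_cong:
  "(\<And>x. x \<in> lterm_vars p \<Longrightarrow> \<sigma> x = \<rho> x) \<Longrightarrow> lterm_val \<sigma> p = lterm_val \<rho> p"
  by (induction p) auto

section \<open>Free variables of the translation\<close>

text \<open>Every quantifier block binds the components of the vectors it introduces, so only
  variables of the input vector can survive. A constant vector then gives a closed formula. The
  guard mentions \<open>s (pre r)\<close>, whence the assumption on \<open>rs\<close>.\<close>

lemma lia_free_Trans:
  assumes "\<forall>r\<in>set rs. pre r \<in> set Xs"
  shows "lia_free (Trans Xs rs \<phi> s k m) \<subseteq> (\<Union>X\<in>set Xs. lterm_vars (s X))"
proof (induction \<phi> arbitrary: s m)
  case (ExNext a \<phi>)
  have "lia_free (Trans Xs rs \<phi> (var_vec m) k (m + 1)) \<subseteq> Pair m ` set Xs"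
    using ExNext[of "var_vec m" "m + 1"] by (auto simp: var_vec_def)
  moreover have "lia_free (T_form Xs rs s (var_vec m) a)
      \<subseteq> (\<Union>X\<in>set Xs. lterm_vars (s X)) \<union> Pair m ` set Xs"
    using assms by (auto simp: T_form_def T_minus_def lia_free_ldisj lia_free_lconj var_vec_def)
  ultimately show ?case
    by (auto simp: lia_free_lexists)
next
  case (ExGlobally \<phi>)
  let ?N = "{m..<m + k + 1} \<times> set Xs" and ?U = "\<Union>X\<in>set Xs. lterm_vars (s X)"
  let ?path = "Path_form Xs rs (\<lambda>j. var_vec (m + j)) k"
    and ?init = "lconj (map (\<lambda>X. LEq (var_vec m X) (s X)) Xs)"
    and ?body = "lconj (map (\<lambda>j. Trans Xs rs \<phi> (var_vec (m + j)) k (m + k + 1)) [0..<Suc k])"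
  have "lia_free (Trans Xs rs \<phi> (var_vec (m + j)) k (m + k + 1)) \<subseteq> ?N" if "j < Suc k" for j
    using ExGlobally[of "var_vec (m + j)" "m + k + 1"] that by (auto simp: var_vec_def)
  then have body: "lia_free ?body \<subseteq> ?N"
    unfolding lia_free_lconj set_map set_upt image_image by (intro UN_least) simp
  \<comment> \<open>Step \<open>j\<close> runs over 1 to k and uses positions \<open>j - 1\<close>
    and \<open>j\<close>, so all indices lie between m and m + k.\<close>
  have path: "lia_free ?path \<subseteq> ?N"
    using assms
    by (auto simp: Path_form_def T_minus_def lia_free_ldisj lia_free_lconj var_vec_def)
  have init: "lia_free ?init \<subseteq> ?N \<union> ?U"
    by (auto simp: lia_free_lconj var_vec_def)
  have "lia_free (Trans Xs rs (ExGlobally \<phi>) s k m) =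
      (lia_free ?path \<union> (lia_free ?init \<union> lia_free ?body)) - ?N"
    by (simp only: Trans.simps lia_free_lexists lia_free.simps set_product set_upt)
  also have "\<dots> \<subseteq> ?U"
    unfolding Diff_subset_conv by (intro Un_least init le_supI1[OF path] le_supI1[OF body])
  finally show ?case .
qed (auto simp: lterm_vars_lsum)

section \<open>Correctness of the translation\<close>

text \<open>The link between integer vectors and states: it forces the values on \<open>V\<close> to
  be nonnegative, and membership in \<open>bpp_states V\<close> fixes the multiset outside
  \<open>V\<close>.\<close>

definition encodes :: "'v set \<Rightarrow> (nat \<times> 'v \<Rightarrow> int) \<Rightarrow> 'v vec \<Rightarrow> 'v multiset \<Rightarrow> bool" where
  "encodes V \<rho> p s \<longleftrightarrow> s \<in> bpp_states V \<and> (\<forall>X\<in>V. lterm_val \<rho> (p X) = int (count s X))"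

lemma encodes_unique:
  assumes "encodes V \<rho> p s" and "encodes V \<rho> p t"
  shows "s = t"
proof (rule multiset_eqI)
  fix X
  show "count s X = count t X"
  proof (cases "X \<in> V")
    case True
    with assms show ?thesis by (simp add: encodes_def)
  next
    case False
    with assms have "X \<notin># s" "X \<notin># t" by (auto simp: encodes_def bpp_states_def)
    then show ?thesis by (simp add: not_in_iff)
  qed
qed

lemma encodes_cong:
  assumes "\<And>x X. X \<in> V \<Longrightarrow> x \<in> lterm_vars (p X) \<Longrightarrow> \<sigma> x = \<rho> x"
  shows "encodes V \<sigma> p s \<longleftrightarrow> encodes V \<rho> p s"
proof -
  have "lterm_val \<sigma> (p X) = lterm_val \<rho> (p X)" if "X \<in> V" for X
    using assms[OF that] by (rule lterm_val_cong)
  then show ?thesis by (simp add: encodes_def)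
qed

text \<open>The guard lets one copy of \<open>pre r\<close> be split off \<open>s\<close>. The
  equations of \<open>T_minus\<close> then say that \<open>q\<close> has the values of
  \<open>\<beta> + post r\<close>, so the integer vector \<open>q\<close> is nonnegative without a
  separate constraint.\<close>

lemma rule_constraint_iff:
  assumes p: "encodes V \<rho> p s" and r: "pre r \<in> V" "set_mset (post r) \<subseteq> V" and Xs: "set Xs = V"
  shows "lterm_val \<rho> (p (pre r)) \<ge> 1 \<and> lia_sat \<rho> (T_minus Xs p q r) \<longleftrightarrow>
         (\<exists>\<beta>. s = \<beta> + {#pre r#} \<and> encodes V \<rho> q (\<beta> + post r))" (is "?L \<longleftrightarrow> ?R")
proof -
  have T: "lia_sat \<rho> (T_minus Xs p q r) \<longleftrightarrow>
      (\<forall>X\<in>V. int (count s X) + P_minus (pre r) (post r) X = lterm_val \<rho> (q X))"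
    using p Xs by (auto simp: T_minus_def lia_sat_lconj encodes_def)
  \<comment> \<open>The -1 in \<open>P_minus\<close> cancels exactly the consumed symbol.\<close>
  have eff: "int (count (\<beta> + {#pre r#}) X) + P_minus (pre r) (post r) X = int (count (\<beta> + post r) X)"
    for \<beta> X
    by (simp add: P_minus_def)
  have guard: "lterm_val \<rho> (p (pre r)) \<ge> 1 \<longleftrightarrow> pre r \<in># s"
    using p r by (auto simp: encodes_def simp flip: count_greater_zero_iff)
  have states: "\<beta> + post r \<in> bpp_states V" if "s = \<beta> + {#pre r#}" for \<beta>
    using p r that by (auto simp: encodes_def bpp_states_def)
  show ?thesis
  proof
    assume L: ?L
    with guard obtain \<beta> where \<beta>: "s = \<beta> + {#pre r#}"
      by (metis insert_DiffM2)
    with L T eff states[OF \<beta>] show ?R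
      by (auto simp: encodes_def)
  next
    assume ?R
    then obtain \<beta> where \<beta>: "s = \<beta> + {#pre r#}" "encodes V \<rho> q (\<beta> + post r)"
      by blast
    with guard T eff show ?L
      by (auto simp: encodes_def)
  qed
qed

text \<open>Phrased with a quantifier over rules instead of a formula, so that it serves both
  \<open>T_form\<close> and the conjuncts of \<open>Path_form\<close>.\<close>

lemma step_constraint_iff:
  assumes bpp: "is_bpp V \<Delta>" and p: "encodes V \<rho> p s" and Xs: "set Xs = V"
  shows "(\<exists>r\<in>\<Delta>. act r = a \<and> lterm_val \<rho> (p (pre r)) \<ge> 1 \<and> lia_sat \<rho> (T_minus Xs p q r)) \<longleftrightarrow>
         (\<exists>t. bpp_step \<Delta> s a t \<and> encodes V \<rho> q t)"
proof -
  have "lterm_val \<rho> (p (pre r)) \<ge> 1 \<and> lia_sat \<rho> (T_minus Xs p q r) \<longleftrightarrow>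
         (\<exists>\<beta>. s = \<beta> + {#pre r#} \<and> encodes V \<rho> q (\<beta> + post r))" if "r \<in> \<Delta>" for r
    using bpp that by (intro rule_constraint_iff[OF p _ _ Xs]) (auto simp: is_bpp_def)
  then show ?thesis
    unfolding bpp_step_def by blast
qed

lemma lia_sat_T_form:
  assumes "is_bpp V \<Delta>" and "encodes V \<rho> p s" and "set Xs = V" and "set rs = \<Delta>"
  shows "lia_sat \<rho> (T_form Xs rs p q a) \<longleftrightarrow> (\<exists>t. bpp_step \<Delta> s a t \<and> encodes V \<rho> q t)"
  using step_constraint_iff[OF assms(1-3), of a q] assms(4)
  by (auto simp: T_form_def lia_sat_ldisj)

text \<open>Only the first vector is assumed to encode a state; each step constraint passes this
  property on to the next vector.\<close>

lemma lia_sat_Path_form: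
  assumes bpp: "is_bpp V \<Delta>" and u0: "encodes V \<rho> (u 0) s" and Xs: "set Xs = V"
    and rs: "set rs = \<Delta>"
  shows "lia_sat \<rho> (Path_form Xs rs u k) \<longleftrightarrow>
         (\<exists>\<pi>. \<pi> 0 = s \<and> (\<forall>j\<le>k. encodes V \<rho> (u j) (\<pi> j)) \<and>
              (\<forall>j\<in>{1..k}. \<exists>b. bpp_step \<Delta> (\<pi> (j - 1)) b (\<pi> j)))" (is "_ \<longleftrightarrow> ?R")
proof -
  define C where "C j \<longleftrightarrow> (\<exists>r\<in>\<Delta>. lterm_val \<rho> (u (j - 1) (pre r)) \<ge> 1 \<and>
    lia_sat \<rho> (T_minus Xs (u (j - 1)) (u j) r))" for j
  have path: "lia_sat \<rho> (Path_form Xs rs u k) \<longleftrightarrow> (\<forall>j\<in>{1..k}. C j)"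
    using rs by (auto simp: Path_form_def lia_sat_lconj lia_sat_ldisj C_def)
  have C: "C j \<longleftrightarrow> (\<exists>b t. bpp_step \<Delta> v b t \<and> encodes V \<rho> (u j) t)"
    if "encodes V \<rho> (u (j - 1)) v" for j v
    using step_constraint_iff[OF bpp that Xs, of _ "u j"] unfolding C_def by blast
  have "(\<forall>j\<in>{1..k}. C j) \<longleftrightarrow> ?R"
  proof
    assume all: "\<forall>j\<in>{1..k}. C j"
    have ex: "\<exists>v. encodes V \<rho> (u j) v" if "j \<le> k" for j
      using that
    proof (induction j)
      case 0
      show ?case using u0 by blast
    next
      case (Suc j)
      then obtain v where "encodes V \<rho> (u (Suc j - 1)) v" by auto
      with C[of "Suc j"] all Suc.prems show ?case by fastforce
    qed
    \<comment> \<open>The states are chosen independently of each other. They still form a run: the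
      successor supplied by \<open>C\<close> is encoded by the same vector as
      \<open>\<pi> j\<close>, hence equals it by \<open>encodes_unique\<close>.\<close>
    define \<pi> where "\<pi> j = (SOME v. encodes V \<rho> (u j) v)" for j
    have \<pi>: "encodes V \<rho> (u j) (\<pi> j)" if "j \<le> k" for j
      unfolding \<pi>_def by (rule someI_ex[OF ex[OF that]])
    have "\<exists>b. bpp_step \<Delta> (\<pi> (j - 1)) b (\<pi> j)" if j: "j \<in> {1..k}" for j
    proof -
      have "encodes V \<rho> (u (j - 1)) (\<pi> (j - 1))" "encodes V \<rho> (u j) (\<pi> j)"
        using \<pi> j by auto
      with C all j show ?thesis
        using encodes_unique by metis
    qed
    moreover have "\<pi> 0 = s"
      using \<pi>[of 0] u0 by (auto intro: encodes_unique)
    ultimately show ?R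
      using \<pi> by blast
  next
    assume ?R
    then obtain \<pi> where \<pi>: "\<forall>j\<le>k. encodes V \<rho> (u j) (\<pi> j)"
      "\<forall>j\<in>{1..k}. \<exists>b. bpp_step \<Delta> (\<pi> (j - 1)) b (\<pi> j)"
      by blast
    show "\<forall>j\<in>{1..k}. C j"
    proof
      fix j assume j: "j \<in> {1..k}"
      then have "encodes V \<rho> (u (j - 1)) (\<pi> (j - 1))" "encodes V \<rho> (u j) (\<pi> j)"
        using \<pi>(1) by auto
      with C \<pi>(2) j show "C j" by blast
    qed
  qed
  with path show ?thesis by simp
qed

text \<open>Negation swaps the two directions, so they must be proved together. The bound on
  \<open>lterm_vars\<close> expresses that indices from \<open>m\<close> on are fresh for
  \<open>p\<close>.\<close>

lemma lia_sat_Trans_iff: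
  fixes V :: "'v set" and \<Delta> :: "('v, 'a) rule set"
  assumes bpp: "is_bpp V \<Delta>" and dist: "distinct Xs" and Xs: "set Xs = V" and rs: "set rs = \<Delta>"
    and "encodes V \<rho> p s" and "\<forall>X\<in>V. lterm_vars (p X) \<subseteq> {..<m} \<times> UNIV"
  shows "lia_sat \<rho> (Trans Xs rs \<phi> p k m) \<longleftrightarrow> bounded_sat V \<Delta> k s \<phi>"
  using assms(5,6)
proof (induction \<phi> arbitrary: \<rho> p s m)
  case (Atom a b)
  have "lterm_val \<rho> (lsum (map (\<lambda>X. LScale (int (a X)) (p X)) Xs)) =
      (\<Sum>X\<in>V. int (a X) * lterm_val \<rho> (p X))"
    using dist Xs by (auto simp: lterm_val_lsum comp_def sum_list_distinct_conv_sum_set)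
  also have "\<dots> = int (\<Sum>X\<in>V. a X * count s X)"
    using Atom(1) by (simp add: encodes_def)
  finally show ?case
    by (simp only: Trans.simps lia_sat.simps lterm_val.simps bounded_sat.simps of_nat_le_iff)
next
  case (Neg \<phi>)
  then show ?case by simp
next
  case (Conj \<phi> \<psi>)
  then show ?case by simp
next
  case (ExNext a \<phi>)
  have IH: "lia_sat \<sigma> (Trans Xs rs \<phi> (var_vec m) k (m + 1)) \<longleftrightarrow> bounded_sat V \<Delta> k t \<phi>"
    if "encodes V \<sigma> (var_vec m) t" for \<sigma> t
    by (rule ExNext.IH[OF that]) (auto simp: var_vec_def)
  \<comment> \<open>Only index \<open>m\<close> is reassigned, while \<open>p\<close> uses indices
    below \<open>m\<close>.\<close>
  have keep: "encodes V \<sigma> p s" if "\<forall>x. x \<notin> Pair m ` V \<longrightarrow> \<sigma> x = \<rho> x" for \<sigma>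
    using ExNext.prems that by (subst encodes_cong[of V p \<sigma> \<rho>]) fastforce+
  have step: "lia_sat \<sigma> (T_form Xs rs p (var_vec m) a) \<longleftrightarrow>
      (\<exists>t. bpp_step \<Delta> s a t \<and> encodes V \<sigma> (var_vec m) t)"
    if "\<forall>x. x \<notin> Pair m ` V \<longrightarrow> \<sigma> x = \<rho> x" for \<sigma>
    by (rule lia_sat_T_form[OF bpp keep[OF that] Xs rs])
  have "lia_sat \<rho> (Trans Xs rs (ExNext a \<phi>) p k m) \<longleftrightarrow> k \<ge> 1 \<and>
      (\<exists>\<sigma>. (\<forall>x. x \<notin> Pair m ` V \<longrightarrow> \<sigma> x = \<rho> x) \<and>
         (\<exists>t. bpp_step \<Delta> s a t \<and> encodes V \<sigma> (var_vec m) t \<and> bounded_sat V \<Delta> k t \<phi>))"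
  proof -
    have "lia_sat \<sigma> (LAnd (T_form Xs rs p (var_vec m) a) (Trans Xs rs \<phi> (var_vec m) k (m + 1))) \<longleftrightarrow>
        (\<exists>t. bpp_step \<Delta> s a t \<and> encodes V \<sigma> (var_vec m) t \<and> bounded_sat V \<Delta> k t \<phi>)"
      if "\<forall>x. x \<notin> Pair m ` V \<longrightarrow> \<sigma> x = \<rho> x" for \<sigma>
      unfolding lia_sat.simps step[OF that] using IH[of \<sigma>] by blast
    moreover have "lia_sat \<rho> (LGe (LConst (int k)) (LConst 1)) \<longleftrightarrow> k \<ge> 1"
      by simp
    ultimately show ?thesis
      unfolding Trans.simps lia_sat_lexists lia_sat.simps(5)[of \<rho>] set_map Xs
      by (intro conj_cong ex_cong1) blast+
  qed
  also have "\<dots> \<longleftrightarrow> bounded_sat V \<Delta> k s (ExNext a \<phi>)"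
  proof -
    \<comment> \<open>Conversely, a successor state is written into the fresh vector by storing its
      Parikh vector at index \<open>m\<close>.\<close>
    have "\<exists>\<sigma>. (\<forall>x. x \<notin> Pair m ` V \<longrightarrow> \<sigma> x = \<rho> x) \<and> encodes V \<sigma> (var_vec m) t"
      if "t \<in> bpp_states V" for t
      using that
      by (intro exI[of _ "\<lambda>x. if x \<in> Pair m ` V then int (count t (snd x)) else \<rho> x"])
        (auto simp: encodes_def var_vec_def)
    moreover have "t \<in> bpp_states V" if "encodes V \<sigma> (var_vec m) t" for \<sigma> t
      using that by (simp add: encodes_def)
    ultimately show ?thesis
      unfolding bounded_sat.simps by blast
  qed
  finally show ?case .
next
  case (ExGlobally \<phi>)
  let ?N = "{m..<m + k + 1} \<times> V"
  let ?u = "\<lambda>j. var_vec (m + j) :: 'v vec"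
  let ?run = "\<lambda>\<pi>. \<pi> 0 = s \<and> (\<forall>j\<in>{1..k}. \<exists>b. bpp_step \<Delta> (\<pi> (j - 1)) b (\<pi> j))"
  \<comment> \<open>From \<open>j \<le> k\<close> follows \<open>m + j < m + k + 1\<close>, so the
    index passed on is fresh for every vector of the path.\<close>
  have IH: "lia_sat \<sigma> (Trans Xs rs \<phi> (?u j) k (m + k + 1)) \<longleftrightarrow> bounded_sat V \<Delta> k t \<phi>"
    if "encodes V \<sigma> (?u j) t" "j \<le> k" for \<sigma> t j
    using that(2) by (intro ExGlobally.IH[OF that(1)]) (auto simp: var_vec_def)
  have init: "(\<forall>X\<in>V. lterm_val \<sigma> (?u 0 X) = lterm_val \<sigma> (p X)) \<longleftrightarrow> encodes V \<sigma> (?u 0) s"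
    if "\<forall>x. x \<notin> ?N \<longrightarrow> \<sigma> x = \<rho> x" for \<sigma>
  proof -
    have "encodes V \<sigma> p s"
      using ExGlobally.prems that by (subst encodes_cong[of V p \<sigma> \<rho>]) fastforce+
    then show ?thesis by (auto simp: encodes_def)
  qed
  have "lia_sat \<rho> (Trans Xs rs (ExGlobally \<phi>) p k m) \<longleftrightarrow>
      (\<exists>\<sigma>. (\<forall>x. x \<notin> ?N \<longrightarrow> \<sigma> x = \<rho> x) \<and> lia_sat \<sigma> (Path_form Xs rs ?u k) \<and>
         (\<forall>X\<in>V. lterm_val \<sigma> (?u 0 X) = lterm_val \<sigma> (p X)) \<and>
         (\<forall>j\<le>k. lia_sat \<sigma> (Trans Xs rs \<phi> (?u j) k (m + k + 1))))"
  proof -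
    have "set (List.product [m..<m + k + 1] Xs) = ?N" using Xs by auto
    moreover have "(\<forall>j\<in>{0..<Suc k}. P j) \<longleftrightarrow> (\<forall>j\<le>k. P j)" for P by auto
    ultimately show ?thesis
      using Xs by (simp add: lia_sat_lexists lia_sat_lconj del: upt_Suc)
  qed
  also have "\<dots> \<longleftrightarrow> (\<exists>\<sigma>. (\<forall>x. x \<notin> ?N \<longrightarrow> \<sigma> x = \<rho> x) \<and>
      (\<exists>\<pi>. ?run \<pi> \<and> (\<forall>j\<le>k. encodes V \<sigma> (?u j) (\<pi> j)) \<and> (\<forall>j\<le>k. bounded_sat V \<Delta> k (\<pi> j) \<phi>)))"
  proof (intro ex_cong1 conj_cong refl)
    fix \<sigma> assume \<sigma>: "\<forall>x. x \<notin> ?N \<longrightarrow> \<sigma> x = \<rho> x"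
    show "(lia_sat \<sigma> (Path_form Xs rs ?u k) \<and>
         (\<forall>X\<in>V. lterm_val \<sigma> (?u 0 X) = lterm_val \<sigma> (p X)) \<and>
         (\<forall>j\<le>k. lia_sat \<sigma> (Trans Xs rs \<phi> (?u j) k (m + k + 1)))) \<longleftrightarrow>
      (\<exists>\<pi>. ?run \<pi> \<and> (\<forall>j\<le>k. encodes V \<sigma> (?u j) (\<pi> j)) \<and> (\<forall>j\<le>k. bounded_sat V \<Delta> k (\<pi> j) \<phi>))"
      (is "?L \<longleftrightarrow> ?R")
    proof
      assume L: ?L
      \<comment> \<open>The initial equations come first: \<open>lia_sat_Path_form\<close> needs a
        starting vector that encodes a state.\<close>
      with init[OF \<sigma>] have "encodes V \<sigma> (?u 0) s" by blast
      with L obtain \<pi> where "?run \<pi>" "\<forall>j\<le>k. encodes V \<sigma> (?u j) (\<pi> j)"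
        using lia_sat_Path_form[OF bpp _ Xs rs, of \<sigma> ?u s k] by blast
      with L IH show ?R by blast
    next
      assume ?R
      then obtain \<pi> where \<pi>: "?run \<pi>" "\<forall>j\<le>k. encodes V \<sigma> (?u j) (\<pi> j)"
        "\<forall>j\<le>k. bounded_sat V \<Delta> k (\<pi> j) \<phi>"
        by blast
      then have u0: "encodes V \<sigma> (?u 0) s" by blast
      with \<pi> have "lia_sat \<sigma> (Path_form Xs rs ?u k)"
        using lia_sat_Path_form[OF bpp _ Xs rs, of \<sigma> ?u s k] by blast
      with u0 init[OF \<sigma>] \<pi> IH show ?L by blast
    qed
  qed
  also have "\<dots> \<longleftrightarrow> bounded_sat V \<Delta> k s (ExGlobally \<phi>)"
  proof -
    \<comment> \<open>One assignment stores the whole run: index m + j holds the Parikh vector of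
      \<open>\<pi> j\<close>, and \<open>fst x - m\<close> recovers the position; inside
      \<open>?N\<close> this subtraction is not truncated.\<close>
    have "\<exists>\<sigma>. (\<forall>x. x \<notin> ?N \<longrightarrow> \<sigma> x = \<rho> x) \<and> (\<forall>j\<le>k. encodes V \<sigma> (?u j) (\<pi> j))"
      if "\<forall>j\<le>k. \<pi> j \<in> bpp_states V" for \<pi>
      using that
      by (intro exI[of _ "\<lambda>x. if x \<in> ?N then int (count (\<pi> (fst x - m)) (snd x)) else \<rho> x"])
        (auto simp: encodes_def var_vec_def)
    moreover have "\<pi> j \<in> bpp_states V" if "encodes V \<sigma> (?u j) (\<pi> j)" for \<sigma> \<pi> j
      using that by (simp add: encodes_def)
    ultimately show ?thesis
      unfolding bounded_sat.simps by blast
  qed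
  finally show ?case .
qed

theorem theorem4:
  fixes V :: "'v set" and \<Delta> :: "('v, 'a) rule set"
    and Xs :: "'v list" and rs :: "('v, 'a) rule list"
    and \<phi> :: "('v, 'a) eg_formula" and s :: "'v multiset" and k :: nat
  assumes "is_bpp V \<Delta>"
    and "distinct Xs" and "set Xs = V"
    and "distinct rs" and "set rs = \<Delta>"
    and "s \<in> bpp_states V"
  shows "(Trans_dom (Xs, rs, \<phi>, const_vec s, k, 0) \<and>
          finite {c. Trans_rel\<^sup>*\<^sup>* c (Xs, rs, \<phi>, const_vec s, k, 0)}) \<and>
         lia_closed (Trans Xs rs \<phi> (const_vec s) k 0) \<and>
         (bounded_sat V \<Delta> k s \<phi> \<longrightarrow> lia_true (Trans Xs rs \<phi> (const_vec s) k 0)) \<and>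
         (lia_true (Trans Xs rs \<phi> (const_vec s) k 0) \<longrightarrow> bounded_sat V \<Delta> k s \<phi>)"
proof -
  have "\<forall>r\<in>set rs. pre r \<in> set Xs"
    using assms by (auto simp: is_bpp_def)
  then have "lia_free (Trans Xs rs \<phi> (const_vec s) k 0) \<subseteq> {}"
    using lia_free_Trans[of rs Xs \<phi> "const_vec s" k 0] by (simp add: const_vec_def)
  \<comment> \<open>Constant terms have no variables, so index 0 is already fresh. The right side is
    independent of \<open>\<rho>\<close>, so truth under all assignments is equivalent to
    it.\<close>
  moreover have "lia_sat \<rho> (Trans Xs rs \<phi> (const_vec s) k 0) \<longleftrightarrow> bounded_sat V \<Delta> k s \<phi>" for \<rho>
    using assms by (intro lia_sat_Trans_iff) (auto simp: encodes_def const_vec_def)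
  ultimately show ?thesis
    using Trans_dom_all finite_Trans_calls by (auto simp: lia_closed_def lia_true_def)
qed

end
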